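(* Let $m\le n$ and let $A,V\in\mathbb{R}^{m\times n}$, with rows $a_1^T,\dots,a_m^T$ and $v_1^T,\dots,v_m^T$ respectively, both have full row rank, with $AV^T$ non-singular and $\langle a_i,v_i\rangle>0$ for all $i$. Let $b\in\mathbb{R}^m$ and consider the consistent system $Ax=b$. Let the columns of $Z\in\mathbb{R}^{n\times m}$ form an orthonormal basis of the range $\operatorname{rg}V^T$ of $V^T$. Let $p\in\mathbb{R}^m$ with $p_i\ge0$ and $\sum_ip_i=1$, and set $D=\operatorname{Diag}\big(\tfrac{p_i}{\langle a_i,v_i\rangle}\big)$ and $S=\operatorname{Diag}\big(\tfrac{\|v_i\|^2}{\langle a_i,v_i\rangle}\big)$. Let $(x_k)_{k\ge0}$ be the iterates of the randomized Kaczmarz method with mismatched adjoint (defined in the context) started at a deterministic $x_0\in\mathbb{R}^n$. Then: (1) The system $Ax=b$ has exactly one solution $\hat x$ that lies in $\operatorname{rg}V^T$. (2) If $x_0\in\operatorname{rg}V^T$ and $\rho(I-Z^TV^TDAZ)<1$, then $\mathbb{E}(x_k-\hat x)\to0$ as $k\to\infty$. (3) If $x_0\in\operatorname{rg}V^T$ and $\lambda:=\lambda_{\min}\big(Z^T(V^TDA+A^TDV-A^TSDA)Z\big)>0$, then for all $k\ge0$ $$\mathbb{E}\big[\|x_{k+1}-\hat x\|^2\big]\le(1-\lambda)\,\mathbb{E}\big[\|x_k-\hat x\|^2\big].$$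
   Context: The randomized Kaczmarz method with mismatched adjoint for $Ax=b$: given $x_0$, at each step $k=0,1,2,\dots$ choose an index $i_k\in\{1,\dots,m\}$ at random, independently of the previous choices, with $\Pr(i_k=i)=p_i$, and set $$x_{k+1}=x_k-\frac{\langle a_{i_k},x_k\rangle-b_{i_k}}{\langle a_{i_k},v_{i_k}\rangle}\,v_{i_k}.$$ Expectations are over all random indices. $\langle\cdot,\cdot\rangle$ and $\|\cdot\|$ are the Euclidean inner product and norm. $\rho(M)$ is the spectral radius (largest absolute value of the complex eigenvalues) of a real square matrix $M$; $\lambda_{\min}(M)$ is the smallest eigenvalue of a real symmetric matrix $M$. $\operatorname{Diag}(d_i)$ is the diagonal matrix with entries $d_1,\dots,d_m$. *)

theory Defs
  imports "HOL-Analysis.Analysis" "HOL-Probability.Probability"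
begin

definition Diag :: "'a::zero ^ 'm \<Rightarrow> 'a ^ 'm ^ 'm" where
  "Diag d = (\<chi> i j. if i = j then d $ i else 0)"

definition matrix_range :: "real ^ 'n ^ 'm \<Rightarrow> (real ^ 'm) set" where
  "matrix_range B = range (\<lambda>y. B *v y)"

text \<open>The columns are indexed by the type \<^typ>\<open>'k\<close>, so orthonormality makes them pairwise
  distinct and linearly independent.\<close>

definition orthonormal_basis_columns :: "real ^ 'k ^ 'n \<Rightarrow> (real ^ 'n) set \<Rightarrow> bool" where
  "orthonormal_basis_columns Z W \<longleftrightarrow>
     (\<forall>i j. column i Z \<bullet> column j Z = (if i = j then 1 else 0)) \<and> span (columns Z) = W"

definition matrix_eigenvalues :: "'a::field ^ 'n ^ 'n \<Rightarrow> 'a set" where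
  "matrix_eigenvalues M = {c. \<exists>v. v \<noteq> 0 \<and> M *v v = c *s v}"

text \<open>\<^const>\<open>Max\<close> and \<^const>\<open>Min\<close> are applied to finite sets. A complex square matrix has at
  least one eigenvalue, and so has a real symmetric one, the only case in which
  \<open>matrix_lambda_min\<close> is meaningful.\<close>

definition matrix_spectral_radius :: "real ^ 'n ^ 'n \<Rightarrow> real" where
  "matrix_spectral_radius M =
     Max (cmod ` matrix_eigenvalues (map_matrix complex_of_real M))"

definition matrix_lambda_min :: "real ^ 'n ^ 'n \<Rightarrow> real" where
  "matrix_lambda_min M = Min (matrix_eigenvalues M)"

primrec kaczmarz_mismatched ::
  "real ^ 'n ^ 'm \<Rightarrow> real ^ 'n ^ 'm \<Rightarrow> real ^ 'm \<Rightarrow> real ^ 'n \<Rightarrow> (nat \<Rightarrow> 'm) \<Rightarrow> nat \<Rightarrow> real ^ 'n"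
where
  "kaczmarz_mismatched A V b x0 \<sigma> 0 = x0"
| "kaczmarz_mismatched A V b x0 \<sigma> (Suc k) =
     (let x = kaczmarz_mismatched A V b x0 \<sigma> k; i = \<sigma> k
      in x - ((A $ i \<bullet> x - b $ i) / (A $ i \<bullet> V $ i)) *\<^sub>R V $ i)"

end

(* Conditionally on the first k indices, the error e = x_k - xh moves in the mean to (I - V^T D A) e
   and its squared norm to |e|^2 - <e, N e> with N = V^T D A + A^T D V - A^T S D A. Errors stay in
   rg V^T, where e = Z y, so the mean is driven by the powers of I - Z^T V^T D A Z, and the quadratic
   form is bounded below by the smallest eigenvalue of Z^T N Z. *)

theory Submission
  imports Defs "HOL-Computational_Algebra.Fundamental_Theorem_Algebra"
begin

text \<open>Passing to coordinates in \<open>Z\<close> is forced: for m < n the matrix I - V^T D A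
  fixes the kernel of A, so its powers cannot decay on the whole space. On rg V^T the passage is
  exact, because V^T D A maps into that range and Z Z^T acts there as the identity. The compressed
  matrix need not be symmetric or diagonalizable, and a spectral radius below 1 does not make its
  norm smaller than 1. Decay of its powers is therefore obtained from a polynomial that annihilates
  the start vector, whose complex linear factors are removed one at a time. The same polynomials
  show that a matrix has finitely many eigenvalues, which is what makes the \<open>Max\<close> and
  \<open>Min\<close> in the definitions usable as bounds. Conditioning is done by splitting on the
  value of the next index: each iterate takes finitely many values and depends only on earlier
  indices, so every expectation exists and every product factors.\<close>

section \<open>Polynomials in a matrix and powers of a matrix\<close>

text \<open>This is q(M) v by Horner's scheme. It acts on a vector directly, because annihilating
  polynomials are sought for single vectors.\<close>

definition matrix_poly_apply :: "'a::field ^ 'n ^ 'n \<Rightarrow> 'a poly \<Rightarrow> 'a ^ 'n \<Rightarrow> 'a ^ 'n" where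
  "matrix_poly_apply M q v = fold_coeffs (\<lambda>a w. a *s v + M *v w) q 0"

lemma matrix_poly_apply_0 [simp]: "matrix_poly_apply M 0 v = 0"
  by (simp add: matrix_poly_apply_def)

lemma matrix_poly_apply_pCons [simp]:
  "matrix_poly_apply M (pCons a q) v = a *s v + M *v matrix_poly_apply M q v"
  by (cases "q = 0 \<and> a = 0") (auto simp: matrix_poly_apply_def)

lemma matrix_poly_apply_zero_vec [simp]: "matrix_poly_apply M q 0 = 0"
  by (induction q) auto

lemma matrix_poly_apply_add:
  "matrix_poly_apply M (q + r) v = matrix_poly_apply M q v + matrix_poly_apply M r v"
  by (induction q r rule: poly_induct2)
    (simp_all add: matrix_vector_right_distrib vector_sadd_rdistrib)

lemma matrix_poly_apply_smult:
  "matrix_poly_apply M (smult c q) v = c *s matrix_poly_apply M q v"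
  by (induction q) (simp_all add: vec.scale vec.scale_right_distrib vector_smult_assoc)

lemma matrix_poly_apply_add_vec:
  "matrix_poly_apply M q (v + w) = matrix_poly_apply M q v + matrix_poly_apply M q w"
  by (induction q) (simp_all add: matrix_vector_right_distrib vec.scale_right_distrib)

lemma matrix_poly_apply_smult_vec:
  "matrix_poly_apply M q (c *s v) = c *s matrix_poly_apply M q v"
  by (induction q)
    (simp_all add: vec.scale vec.scale_right_distrib vector_smult_assoc mult.commute)

lemma matrix_poly_apply_sum_vec:
  "matrix_poly_apply M q (sum f I) = (\<Sum>i\<in>I. matrix_poly_apply M q (f i))"
  by (induction I rule: infinite_finite_induct) (simp_all add: matrix_poly_apply_add_vec)

lemma matrix_poly_apply_sum:
  "matrix_poly_apply M (sum f I) v = (\<Sum>i\<in>I. matrix_poly_apply M (f i) v)"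
  by (induction I rule: infinite_finite_induct) (simp_all add: matrix_poly_apply_add)

text \<open>Since polynomial multiplication commutes, this allows the factors of an annihilating
  polynomial to be applied in any order.\<close>

lemma matrix_poly_apply_mult:
  "matrix_poly_apply M (q * r) v = matrix_poly_apply M q (matrix_poly_apply M r v)"
  by (induction q) (simp_all add: matrix_poly_apply_add matrix_poly_apply_smult)

lemma matrix_poly_apply_monom:
  "matrix_poly_apply M (monom c i) v = c *s (((*v) M) ^^ i) v"
  by (induction i) (simp_all add: monom_0 monom_Suc vec.scale)

lemma matrix_poly_apply_eigenvector:
  assumes "M *v v = c *s v"
  shows "matrix_poly_apply M q v = poly q c *s v"
  by (induction q)
    (simp_all add: assms vec.scale vector_smult_assoc vector_sadd_rdistrib mult.commute)

text \<open>The n + 1 Krylov vectors v, M v, ..., M^n v lie in dimension n; the coefficients of a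
  linear dependence are those of \<open>q\<close>.\<close>

lemma ex_poly_annihilating_vector:
  fixes M :: "'a::field ^ 'n ^ 'n"
  obtains q where "q \<noteq> 0" "matrix_poly_apply M q v = 0"
proof -
  define f where "f i = (((*v) M) ^^ i) v" for i
  let ?I = "{..CARD('n)}"
  show thesis
  proof (cases "inj_on f ?I")
    case True
    then have "card (f ` ?I) = CARD('n) + 1" by (simp add: card_image)
    then have "vec.dependent (f ` ?I)"
      using vec.independent_bound_general[of "f ` ?I"] vec.dim_subset_UNIV[of "f ` ?I"]
      by (auto simp: vec.dimension_def card_cart_basis)
    then obtain u where u: "\<exists>w\<in>f ` ?I. u w \<noteq> 0" "(\<Sum>w\<in>f ` ?I. u w *s w) = 0"
      using vec.dependent_finite[of "f ` ?I"] by auto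
    define q where "q = (\<Sum>i\<in>?I. monom (u (f i)) i)"
    have "matrix_poly_apply M q v = (\<Sum>i\<in>?I. u (f i) *s f i)"
      by (simp add: q_def matrix_poly_apply_sum matrix_poly_apply_monom f_def)
    also have "\<dots> = 0"
      using u(2) True by (simp add: sum.reindex)
    finally have "matrix_poly_apply M q v = 0" .
    moreover have "q \<noteq> 0"
    proof -
      obtain i where i: "i \<in> ?I" "u (f i) \<noteq> 0" using u(1) by auto
      then have "coeff q i = u (f i)"
        by (simp add: q_def coeff_sum)
      with i show ?thesis by auto
    qed
    ultimately show thesis by (rule that[rotated])
  next
    case False
    \<comment> \<open>Dependence is a property of sets and may be lost when two Krylov vectors
      coincide; then X^i - X^j annihilates \<open>v\<close>.\<close>
    then obtain i j where ij: "i \<noteq> j" "f i = f j" by (auto simp: inj_on_def)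
    have "coeff (monom 1 i + monom (- 1) j :: 'a poly) i = 1" using ij by simp
    then have "(monom 1 i + monom (- 1) j :: 'a poly) \<noteq> 0" by (metis coeff_0 zero_neq_one)
    moreover have "matrix_poly_apply M (monom 1 i + monom (- 1) j) v = 0"
      using ij by (simp add: matrix_poly_apply_add matrix_poly_apply_monom f_def)
    ultimately show thesis by (rule that)
  qed
qed

text \<open>The annihilators of the unit vectors are multiplied; in the product, the factor
  belonging to a given unit vector can be made to act on it first.\<close>

lemma ex_poly_annihilating_matrix:
  fixes M :: "'a::field ^ 'n ^ 'n"
  obtains q where "q \<noteq> 0" "\<And>v. matrix_poly_apply M q v = 0"
proof -
  have "\<exists>q. q \<noteq> 0 \<and> matrix_poly_apply M q (axis i 1) = 0" for i :: 'n
    using ex_poly_annihilating_vector by metis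
  then obtain q where q: "q i \<noteq> 0" "matrix_poly_apply M (q i) (axis i 1) = 0" for i :: 'n
    by metis
  have "matrix_poly_apply M (prod q UNIV) v = 0" for v
  proof -
    have ax: "matrix_poly_apply M (prod q UNIV) (axis i 1) = 0" for i
    proof -
      have "prod q UNIV = prod q (UNIV - {i}) * q i"
        by (simp add: prod.remove[of UNIV i] mult.commute)
      then show ?thesis by (simp add: matrix_poly_apply_mult q)
    qed
    have "v = (\<Sum>i\<in>UNIV. v $ i *s axis i 1)" by (simp add: basis_expansion)
    then show ?thesis
      by (metis (no_types, lifting) ax matrix_poly_apply_smult_vec matrix_poly_apply_sum_vec
          sum.neutral vector_smult_rzero)
  qed
  moreover have "prod q UNIV \<noteq> 0" using q by simp
  ultimately show thesis by (rule that[rotated])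
qed

text \<open>On an eigenvector q(M) acts as multiplication by q(c), so each eigenvalue is a root of a
  nonzero annihilating polynomial.\<close>

lemma finite_matrix_eigenvalues: "finite (matrix_eigenvalues (M :: 'a::field ^ 'n ^ 'n))"
proof -
  obtain q where q: "q \<noteq> 0" "\<And>v. matrix_poly_apply M q v = 0"
    by (rule ex_poly_annihilating_matrix[of M]) blast
  have "matrix_eigenvalues M \<subseteq> {c. poly q c = 0}"
    using q(2) matrix_poly_apply_eigenvector[of M _ _ q] by (fastforce simp: matrix_eigenvalues_def)
  then show ?thesis using poly_roots_finite[OF q(1)] finite_subset by blast
qed

text \<open>The fixed point of t -> r t + (1 - r) e / 2 is e / 2. Once \<open>b\<close> stays below
  (1 - r) e / 2, each step multiplies the excess of \<open>a\<close> over e / 2 by at most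
  \<open>r\<close>.\<close>

lemma tendsto_0_of_contractive_recursion:
  fixes a b :: "nat \<Rightarrow> real"
  assumes nonneg: "\<And>k. 0 \<le> a k" and r: "0 \<le> r" "r < 1"
    and step: "\<And>k. a (Suc k) \<le> r * a k + b k" and b: "b \<longlonglongrightarrow> 0"
  shows "a \<longlonglongrightarrow> 0"
proof (rule LIMSEQ_I)
  fix e :: real assume "0 < e"
  then have "(1 - r) * (e / 2) > 0" using r by simp
  from LIMSEQ_D[OF b this] obtain K where K: "\<And>k. k \<ge> K \<Longrightarrow> \<bar>b k\<bar> < (1 - r) * (e / 2)"
    by auto
  have bound: "a (K + j) \<le> r ^ j * a K + e / 2" for j
  proof (induction j)
    case 0
    show ?case using \<open>0 < e\<close> by simp
  next
    case (Suc j)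
    have "a (K + Suc j) \<le> r * a (K + j) + b (K + j)" using step by simp
    also have "\<dots> \<le> r * (r ^ j * a K + e / 2) + (1 - r) * (e / 2)"
      using Suc K[of "K + j"] r by (intro add_mono mult_left_mono) auto
    also have "\<dots> = r ^ Suc j * a K + e / 2" by (simp add: field_simps)
    finally show ?case .
  qed
  have "(\<lambda>j. r ^ j * a K) \<longlonglongrightarrow> 0 * a K" using r by (intro tendsto_intros LIMSEQ_realpow_zero) auto
  then have "(\<lambda>j. r ^ j * a K) \<longlonglongrightarrow> 0" by simp
  from LIMSEQ_D[OF this, of "e / 2"] \<open>0 < e\<close>
  obtain J where J: "\<And>j. j \<ge> J \<Longrightarrow> \<bar>r ^ j * a K\<bar> < e / 2" by auto
  have "norm (a k - 0) < e" if "k \<ge> K + J" for k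
  proof -
    have "K + (k - K) = k" "k - K \<ge> J" using that by auto
    with bound[of "k - K"] J[of "k - K"] nonneg[of k] show ?thesis by (simp add: abs_less_iff)
  qed
  then show "\<exists>k0. \<forall>k\<ge>k0. norm (a k - 0) < e" by blast
qed

text \<open>A factor \<open>X - c\<close> of an annihilating polynomial with \<open>\<bar>c\<bar> \<ge> 1\<close> can be cancelled because \<open>c\<close> is
  not an eigenvalue; a factor with \<open>\<bar>c\<bar> < 1\<close> turns into a contractive recursion.\<close>

lemma matrix_power_tendsto_0:
  fixes M :: "complex ^ 'n ^ 'n"
  assumes ev: "\<And>c. c \<in> matrix_eigenvalues M \<Longrightarrow> cmod c < 1"
  shows "(\<lambda>k. (((*v) M) ^^ k) v) \<longlonglongrightarrow> 0"
proof -
  have "\<lbrakk>degree q = d; q \<noteq> 0; matrix_poly_apply M q v = 0\<rbrakk> \<Longrightarrow> (\<lambda>k. (((*v) M) ^^ k) v) \<longlonglongrightarrow> 0"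
    for q v d
  \<comment> \<open>The vector must vary with the polynomial: a contractive factor is removed by
    passing from \<open>v\<close> to M v - c v.\<close>
  proof (induction d arbitrary: q v)
    case 0
    then obtain a where "q = [:a:]" "a \<noteq> 0" by (metis degree_0_id pCons_0_0 degree_eq_zeroE)
    with 0 have "v = 0" by simp
    then have "(((*v) M) ^^ k) v = 0" for k by (induction k) auto
    then show ?case by simp
  next
    case (Suc d)
    then have "\<not> constant (poly q)" by (simp add: constant_degree)
    then obtain c where "poly q c = 0" using fundamental_theorem_of_algebra by blast
    then obtain r where r: "q = [:- c, 1:] * r" by (metis dvd_def poly_eq_0_iff_dvd)
    with Suc.prems have r0: "r \<noteq> 0" by auto
    then have dr: "degree r = d" using r Suc.prems(1) by (simp add: degree_mult_eq del: mult_pCons_left)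
    show ?case
    proof (cases "cmod c < 1")
      case True
      \<comment> \<open>\<open>w\<close> is annihilated by the cofactor \<open>r\<close> of smaller
        degree, so its powers vanish in the limit and serve as the perturbation in the recursion for
        \<open>v\<close>.\<close>
      define w where "w = matrix_poly_apply M [:- c, 1:] v"
      have w: "w = M *v v - c *s v" by (simp add: w_def)
      have "matrix_poly_apply M r w = 0"
        using Suc.prems(3) unfolding r w_def
        by (metis matrix_poly_apply_mult mult.commute)
      then have lim: "(\<lambda>k. (((*v) M) ^^ k) w) \<longlonglongrightarrow> 0" using Suc.IH dr r0 by blast
      have rec: "(((*v) M) ^^ Suc k) v = c *s (((*v) M) ^^ k) v + (((*v) M) ^^ k) w" for k
      proof (induction k)
        case 0
        show ?case by (simp add: w)
      next
        case (Suc k)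
        have "(((*v) M) ^^ Suc (Suc k)) v = M *v (((*v) M) ^^ Suc k) v" by simp
        also have "\<dots> = M *v (c *s (((*v) M) ^^ k) v + (((*v) M) ^^ k) w)" unfolding Suc ..
        also have "\<dots> = c *s (((*v) M) ^^ Suc k) v + (((*v) M) ^^ Suc k) w"
          by (simp add: matrix_vector_right_distrib vec.scale)
        finally show ?case .
      qed
      have norm_smult: "norm (c *s z) = cmod c * norm z" for z :: "complex ^ 'n"
        by (simp add: norm_vec_def L2_set_right_distrib norm_mult)
      have "(\<lambda>k. norm ((((*v) M) ^^ k) v)) \<longlonglongrightarrow> 0"
      proof (rule tendsto_0_of_contractive_recursion[where r = "cmod c"])
        show "norm ((((*v) M) ^^ Suc k) v)
            \<le> cmod c * norm ((((*v) M) ^^ k) v) + norm ((((*v) M) ^^ k) w)" for k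
          unfolding rec by (metis norm_smult norm_triangle_ineq)
        show "(\<lambda>k. norm ((((*v) M) ^^ k) w)) \<longlonglongrightarrow> 0" using lim by (rule tendsto_norm_zero)
      qed (use True in auto)
      then show ?thesis by (rule tendsto_norm_zero_cancel)
    next
      case False
      then have "c \<notin> matrix_eigenvalues M" using ev by blast
      moreover have "M *v matrix_poly_apply M r v = c *s matrix_poly_apply M r v"
        using Suc.prems(3) unfolding r matrix_poly_apply_mult by simp
      ultimately have "matrix_poly_apply M r v = 0" by (auto simp: matrix_eigenvalues_def)
      then show ?thesis using Suc.IH dr r0 by blast
    qed
  qed
  then show ?thesis using ex_poly_annihilating_vector by metis
qed

text \<open>The spectral radius refers to complex eigenvalues, so the orbit is embedded in complex
  space and recovered by real parts.\<close>

lemma real_matrix_power_tendsto_0: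
  fixes M :: "real ^ 'n ^ 'n"
  assumes "matrix_spectral_radius M < 1"
  shows "(\<lambda>k. (((*v) M) ^^ k) v) \<longlonglongrightarrow> 0"
proof -
  let ?C = "map_matrix complex_of_real M"
  let ?c = "\<lambda>v :: real ^ 'n. \<chi> i. complex_of_real (v $ i)"
  have "cmod c < 1" if "c \<in> matrix_eigenvalues ?C" for c
  proof -
    have "cmod c \<le> matrix_spectral_radius M"
      unfolding matrix_spectral_radius_def
      using that by (intro Max_ge) (auto simp: finite_matrix_eigenvalues)
    with assms show ?thesis by simp
  qed
  then have lim: "(\<lambda>k. (((*v) ?C) ^^ k) (?c v)) \<longlonglongrightarrow> 0" by (rule matrix_power_tendsto_0)
  have pow: "(((*v) ?C) ^^ k) (?c v) = ?c ((((*v) M) ^^ k) v)" for k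
    by (induction k) (simp_all add: vec_eq_iff matrix_vector_mult_def)
  show ?thesis
  proof (rule vec_tendstoI)
    fix i
    have "(\<lambda>k. Re ((((*v) ?C) ^^ k) (?c v) $ i)) \<longlonglongrightarrow> Re ((0 :: complex ^ 'n) $ i)"
      by (intro tendsto_Re tendsto_vec_nth lim)
    then show "(\<lambda>k. (((*v) M) ^^ k) v $ i) \<longlonglongrightarrow> (0 :: real ^ 'n) $ i"
      by (simp add: pow)
  qed
qed

section \<open>The smallest eigenvalue of a symmetric matrix\<close>

lemma inner_matrix_vector_mult:
  fixes M :: "real ^ 'n ^ 'm"
  shows "x \<bullet> (M *v y) = (transpose M *v x) \<bullet> y"
  by (metis dot_lmul_matrix vector_transpose_matrix transpose_transpose)

text \<open>A minimiser of the quadratic form on the unit sphere is an eigenvector: moving it against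
  the residual \<open>w\<close> by a small step \<open>s\<close> would otherwise make \<open>Q\<close> negative.\<close>

lemma matrix_lambda_min_le_quadratic_form:
  fixes B :: "real ^ 'n ^ 'n"
  assumes sym: "transpose B = B"
  shows "matrix_lambda_min B * (y \<bullet> y) \<le> y \<bullet> (B *v y)"
proof -
  have ne: "sphere (0 :: real ^ 'n) 1 \<noteq> {}" by simp
  have cont: "continuous_on (sphere 0 1) (\<lambda>z. z \<bullet> (B *v z))"
    by (intro continuous_intros linear_continuous_on_compose[OF continuous_on_id]
        matrix_vector_mul_linear)
  obtain x where x: "norm x = 1" and xmin: "\<And>z. norm z = 1 \<Longrightarrow> x \<bullet> (B *v x) \<le> z \<bullet> (B *v z)"
    using continuous_attains_inf[OF compact_sphere ne cont] by auto
  define \<mu> where "\<mu> = x \<bullet> (B *v x)"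
  have form: "\<mu> * (z \<bullet> z) \<le> z \<bullet> (B *v z)" for z
  proof (cases "z = 0")
    case False
    have "\<mu> \<le> ((1 / norm z) *\<^sub>R z) \<bullet> (B *v ((1 / norm z) *\<^sub>R z))"
      unfolding \<mu>_def using False by (intro xmin) simp
    also have "\<dots> = z \<bullet> (B *v z) / (z \<bullet> z)"
      by (simp add: matrix_vector_mult_scaleR power2_norm_eq_inner[symmetric] power2_eq_square)
    finally show ?thesis using False by (simp add: field_simps)
  qed simp
  define w where "w = B *v x - \<mu> *\<^sub>R x"
  define Q where "Q z = z \<bullet> (B *v z) - \<mu> * (z \<bullet> z)" for z
  have Q: "Q z \<ge> 0" for z using form[of z] by (simp add: Q_def)
  have xx: "x \<bullet> x = 1" using x by (simp add: dot_square_norm)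
  \<comment> \<open>The constant term is Q x = 0 by the choice of \<mu>; symmetry turns the linear
    term into -2 s times the squared norm of \<open>w\<close>.\<close>
  have Qx: "Q (x - s *\<^sub>R w) = s\<^sup>2 * Q w - 2 * s * (w \<bullet> w)" for s
  proof -
    have "x \<bullet> (B *v w) = w \<bullet> (B *v x)"
      by (metis inner_commute inner_matrix_vector_mult sym)
    moreover have "w \<bullet> (B *v x) = w \<bullet> w + \<mu> * (w \<bullet> x)"
      by (subst (3) w_def) (simp add: inner_diff_right)
    ultimately show ?thesis
      by (simp add: Q_def matrix_vector_mult_diff_distrib matrix_vector_mult_scaleR inner_diff_left
          inner_diff_right \<mu>_def[symmetric] xx inner_commute[of x w] power2_eq_square algebra_simps)
  qed
  have "w \<bullet> w = 0"
  proof (rule ccontr)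
    assume "w \<bullet> w \<noteq> 0"
    then have pos: "w \<bullet> w > 0" by (metis inner_ge_zero order_le_less)
    \<comment> \<open>This step keeps s Q(w) at or below the squared norm of \<open>w\<close>,
      whereas nonnegativity of \<open>Q\<close> requires at least twice that. The 1 keeps the
      denominator positive.\<close>
    define s where "s = (w \<bullet> w) / (Q w + 1)"
    have s: "s > 0" using pos Q[of w] by (simp add: s_def)
    have "s * Q w \<le> w \<bullet> w"
      using pos Q[of w] by (simp add: s_def divide_simps)
    moreover have "0 \<le> s * (s * Q w - 2 * (w \<bullet> w))"
      using Q[of "x - s *\<^sub>R w"] by (simp add: Qx power2_eq_square algebra_simps)
    then have "2 * (w \<bullet> w) \<le> s * Q w" using s by (simp add: zero_le_mult_iff)
    ultimately show False using pos by simp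
  qed
  then have "B *v x = \<mu> *s x" by (simp add: w_def scalar_mult_eq_scaleR)
  then have "\<mu> \<in> matrix_eigenvalues B"
    using x by (auto simp: matrix_eigenvalues_def intro!: exI[of _ x])
  then have "matrix_lambda_min B \<le> \<mu>"
    unfolding matrix_lambda_min_def by (intro Min_le finite_matrix_eigenvalues)
  then show ?thesis using form[of y] by (meson inner_ge_zero mult_right_mono order_trans)
qed

section \<open>Diagonal scalings and orthonormal columns\<close>

lemma Diag_mult_vec: "Diag d *v y = (\<chi> i. d $ i * y $ i)"
  by (simp add: Diag_def matrix_vector_mult_def vec_eq_iff if_distrib[where f = "\<lambda>x. x * _"] cong: if_cong)

lemma Diag_mult_Diag: "Diag c ** Diag d = Diag (\<chi> i. c $ i * d $ i)"
  by (simp add: Diag_def matrix_matrix_mult_def vec_eq_iff if_distrib[where f = "\<lambda>x. x * _"] cong: if_cong)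

lemma transpose_add: "transpose (B + C) = transpose B + transpose C"
  by (simp add: transpose_def vec_eq_iff)

lemma transpose_diff: "transpose (B - C) = transpose B - transpose C"
  by (simp add: transpose_def vec_eq_iff)

lemma transpose_Diag: "transpose (Diag d) = Diag d"
  by (simp add: Diag_def transpose_def vec_eq_iff)

text \<open>V^T Diag(d) A is the sum of the rank-one matrices d_i v_i a_i^T; this links the matrices
  of the theorem to the single row updates.\<close>

lemma transpose_Diag_mult_vec:
  fixes A V :: "real ^ 'n ^ 'm"
  shows "(transpose V ** Diag d ** A) *v x = (\<Sum>i\<in>UNIV. (d $ i * (A $ i \<bullet> x)) *\<^sub>R V $ i)"
  by (simp add: matrix_vector_mul_assoc[symmetric] Diag_mult_vec vec_eq_iff vector_matrix_mult_def
      matrix_vector_mul_component mult.commute)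

lemma orthonormal_basis_columns_transpose_mult:
  assumes "orthonormal_basis_columns Z W"
  shows "transpose Z ** Z = mat 1"
  using assms
  by (simp add: orthonormal_basis_columns_def matrix_mult_transpose_dot_column mat_def vec_eq_iff)

lemma orthonormal_basis_columns_range:
  assumes "orthonormal_basis_columns Z W"
  shows "W = range ((*v) Z)"
proof -
  have "span (columns Z) \<subseteq> range ((*v) Z)"
    by (intro span_minimal linear_subspace_image matrix_vector_mul_linear)
      (auto simp: columns_image_basis)
  moreover have "range ((*v) Z) \<subseteq> span (columns Z)"
    using matrix_vector_mult_in_columnspace by blast
  ultimately show ?thesis using assms by (auto simp: orthonormal_basis_columns_def)
qed

section \<open>The randomized iteration\<close>

text \<open>The \<open>k\<close>-th iterate reads only the indices before \<open>k\<close>; this is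
  the source of its independence from index \<open>k\<close>.\<close>

lemma kaczmarz_mismatched_cong:
  "(\<And>j. j < k \<Longrightarrow> \<sigma> j = \<tau> j) \<Longrightarrow>
    kaczmarz_mismatched A V b x0 \<sigma> k = kaczmarz_mismatched A V b x0 \<tau> k"
  by (induction k) (simp_all add: Let_def)

text \<open>Each step offers finitely many choices. Hence a continuous function of an iterate is
  bounded, which gives its integrability.\<close>

lemma finite_range_kaczmarz_mismatched:
  "finite (range (\<lambda>\<sigma>. kaczmarz_mismatched A V b x0 \<sigma> k))"
proof (induction k)
  case (Suc k)
  let ?X = "range (\<lambda>\<sigma>. kaczmarz_mismatched A V b x0 \<sigma> k)"
  let ?g = "\<lambda>(x, i). x - ((A $ i \<bullet> x - b $ i) / (A $ i \<bullet> V $ i)) *\<^sub>R V $ i"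
  have "range (\<lambda>\<sigma>. kaczmarz_mismatched A V b x0 \<sigma> (Suc k)) \<subseteq> ?g ` (?X \<times> UNIV)"
    by (auto simp: Let_def)
  moreover have "finite (?g ` (?X \<times> UNIV))" using Suc by simp
  ultimately show ?case by (rule finite_subset)
qed simp

text \<open>Only coordinates below \<open>k\<close> are assumed measurable, so that the lemma also
  applies on the product space over \<open>{..<k}\<close>.\<close>

lemma kaczmarz_mismatched_measurable:
  assumes "\<And>j. j < k \<Longrightarrow> (\<lambda>\<omega>. \<sigma> \<omega> j) \<in> measurable M (count_space UNIV)"
  shows "(\<lambda>\<omega>. kaczmarz_mismatched A V b x0 (\<sigma> \<omega>) k) \<in> borel_measurable M"
  using assms
proof (induction k)
  case (Suc k)
  then have [measurable]: "(\<lambda>\<omega>. kaczmarz_mismatched A V b x0 (\<sigma> \<omega>) k) \<in> borel_measurable M"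
    "(\<lambda>\<omega>. \<sigma> \<omega> k) \<in> measurable M (count_space UNIV)" by auto
  show ?case
    unfolding kaczmarz_mismatched.simps Let_def
    by (rule measurable_compose_countable'[where I = UNIV and
        f = "\<lambda>i \<omega>. kaczmarz_mismatched A V b x0 (\<sigma> \<omega>) k
          - ((A $ i \<bullet> kaczmarz_mismatched A V b x0 (\<sigma> \<omega>) k - b $ i) / (A $ i \<bullet> V $ i)) *\<^sub>R V $ i"])
      (auto intro: countable_finite)
qed simp

lemma (in finite_measure) integrable_continuous_kaczmarz_mismatched:
  fixes G :: "real ^ 'n \<Rightarrow> 'b::{banach, second_countable_topology}"
  assumes \<sigma>: "\<And>j. (\<lambda>\<omega>. \<sigma> \<omega> j) \<in> measurable M (count_space UNIV)"
    and G: "continuous_on UNIV G"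
  shows "integrable M (\<lambda>\<omega>. G (kaczmarz_mismatched A V b x0 (\<sigma> \<omega>) k))"
proof -
  let ?R = "range (\<lambda>\<sigma>. kaczmarz_mismatched A V b x0 \<sigma> k)"
  have "finite ((\<lambda>y. norm (G y)) ` ?R)" using finite_range_kaczmarz_mismatched by blast
  then have "norm (G (kaczmarz_mismatched A V b x0 (\<sigma> \<omega>) k)) \<le> Max ((\<lambda>y. norm (G y)) ` ?R)" for \<omega>
    by (intro Max_ge) auto
  moreover have "(\<lambda>\<omega>. G (kaczmarz_mismatched A V b x0 (\<sigma> \<omega>) k)) \<in> borel_measurable M"
    using kaczmarz_mismatched_measurable[OF \<sigma>] borel_measurable_continuous_onI[OF G]
    by (rule measurable_compose)
  ultimately show ?thesis by (intro integrable_const_bound) auto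
qed

text \<open>\<open>F\<close> of the next iterate is a finite sum over \<open>i\<close> of the
  indicator that index \<open>k\<close> equals \<open>i\<close> times a function of the current
  iterate; independence factors each product.\<close>

lemma (in prob_space) expectation_kaczmarz_mismatched_Suc:
  fixes idx :: "nat \<Rightarrow> 'a \<Rightarrow> 'm::finite" and F :: "real ^ 'n \<Rightarrow> real"
    and A V :: "real ^ 'n ^ 'm" and b :: "real ^ 'm" and x0 :: "real ^ 'n"
  assumes indep: "indep_vars (\<lambda>_. count_space UNIV) idx UNIV"
    and F: "continuous_on UNIV F"
  defines "X \<equiv> \<lambda>k \<omega>. kaczmarz_mismatched A V b x0 (\<lambda>j. idx j \<omega>) k"
  shows "expectation (\<lambda>\<omega>. F (X (Suc k) \<omega>)) =
    (\<Sum>i\<in>UNIV. prob {\<omega> \<in> space M. idx k \<omega> = i} *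
      expectation (\<lambda>\<omega>. F (X k \<omega> - ((A $ i \<bullet> X k \<omega> - b $ i) / (A $ i \<bullet> V $ i)) *\<^sub>R V $ i)))"
proof -
  have idx [measurable]: "idx j \<in> measurable M (count_space UNIV)" for j
    using indep unfolding indep_vars_def by auto
  define G where "G i y = F (y - ((A $ i \<bullet> y - b $ i) / (A $ i \<bullet> V $ i)) *\<^sub>R V $ i)" for i y
  define I where "I i j = (if j = i then 1 else 0 :: real)" for i j :: 'm
  \<comment> \<open>A product with an arbitrary \<open>r\<close> replaces the quotient, so
    continuity needs no nonzero denominator.\<close>
  have "continuous_on UNIV (\<lambda>y. F (y - ((A $ i \<bullet> y - b $ i) * r) *\<^sub>R V $ i))" for i r
    by (intro continuous_on_compose2[OF F] continuous_intros) auto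
  then have G: "continuous_on UNIV (G i)" for i
    by (simp add: G_def divide_inverse)
  have G_int: "integrable M (\<lambda>\<omega>. G i (X k \<omega>))" for i
    unfolding X_def using idx G by (intro integrable_continuous_kaczmarz_mismatched) auto
  have I_int: "integrable M (\<lambda>\<omega>. I i (idx k \<omega>))" for i
    by (intro integrable_const_bound[where B = 1]) (auto simp: I_def)
  have I_exp: "expectation (\<lambda>\<omega>. I i (idx k \<omega>)) = prob {\<omega> \<in> space M. idx k \<omega> = i}" for i
  proof -
    have "expectation (\<lambda>\<omega>. I i (idx k \<omega>)) = expectation (indicator {\<omega> \<in> space M. idx k \<omega> = i})"
      by (intro Bochner_Integration.integral_cong) (auto simp: I_def indicator_def)
    also have "\<dots> = prob ({\<omega> \<in> space M. idx k \<omega> = i} \<inter> space M)" by (rule Bochner_Integration.integral_indicator)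
    also have "{\<omega> \<in> space M. idx k \<omega> = i} \<inter> space M = {\<omega> \<in> space M. idx k \<omega> = i}" by auto
    finally show ?thesis .
  qed
  have ind: "indep_var borel (\<lambda>\<omega>. I i (idx k \<omega>)) borel (\<lambda>\<omega>. G i (X k \<omega>))" for i
  proof -
    let ?P = "\<lambda>J. PiM J (\<lambda>_. count_space (UNIV :: 'm set))"
    let ?r = "\<lambda>J \<omega>. restrict (\<lambda>j. idx j \<omega>) J"
    \<comment> \<open>Index \<open>k\<close> and the indices before it form disjoint blocks of the
      independent family.\<close>
    have *: "indep_var (?P {k}) (?r {k}) (?P {..<k}) (?r {..<k})"
      by (intro indep_var_restrict[OF indep]) auto
    have 1: "(\<lambda>\<sigma>. I i (\<sigma> k)) \<in> borel_measurable (?P {k})"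
      by (rule measurable_compose[OF measurable_component_singleton]) auto
    have 2: "(\<lambda>\<sigma>. G i (kaczmarz_mismatched A V b x0 \<sigma> k)) \<in> borel_measurable (?P {..<k})"
      by (rule measurable_compose[OF kaczmarz_mismatched_measurable borel_measurable_continuous_onI[OF G]])
        (auto intro: measurable_component_singleton)
    \<comment> \<open>Restriction alters the index sequence only from position \<open>k\<close> on,
      which iterate \<open>k\<close> never reads.\<close>
    have "kaczmarz_mismatched A V b x0 (?r {..<k} \<omega>) k = X k \<omega>" for \<omega>
      unfolding X_def by (rule kaczmarz_mismatched_cong) simp
    with indep_var_compose[OF * 1 2] show ?thesis by (simp add: comp_def)
  qed
  have "F (X (Suc k) \<omega>) = (\<Sum>i\<in>UNIV. I i (idx k \<omega>) * G i (X k \<omega>))" for \<omega>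
  proof -
    have "(\<Sum>i\<in>UNIV. I i (idx k \<omega>) * G i (X k \<omega>)) = (\<Sum>i\<in>UNIV. if idx k \<omega> = i then G i (X k \<omega>) else 0)"
      by (intro sum.cong) (auto simp: I_def)
    also have "\<dots> = F (X (Suc k) \<omega>)" by (simp add: X_def G_def Let_def)
    finally show ?thesis by simp
  qed
  then have "expectation (\<lambda>\<omega>. F (X (Suc k) \<omega>)) = (\<Sum>i\<in>UNIV. expectation (\<lambda>\<omega>. I i (idx k \<omega>) * G i (X k \<omega>)))"
    using indep_var_integrable[OF ind I_int G_int] by simp
  also have "\<dots> = (\<Sum>i\<in>UNIV. prob {\<omega> \<in> space M. idx k \<omega> = i} * expectation (\<lambda>\<omega>. G i (X k \<omega>)))"
    using indep_var_lebesgue_integral[OF ind I_int G_int] by (simp add: I_exp)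
  finally show ?thesis by (simp add: G_def)
qed

text \<open>Expanding the square, the cross term yields V^T D A and its transpose. The quadratic
  term carries p_i |v_i|^2 / <a_i, v_i>^2, the product of the diagonal entries of \<open>S\<close>
  and \<open>D\<close>.\<close>

lemma sum_norm_kaczmarz_step:
  fixes A V :: "real ^ 'n ^ 'm"
  assumes p1: "(\<Sum>i\<in>UNIV. p $ i) = 1" and av: "\<And>i. A $ i \<bullet> V $ i \<noteq> 0"
  defines "D \<equiv> Diag (\<chi> i. p $ i / (A $ i \<bullet> V $ i))"
    and "S \<equiv> Diag (\<chi> i. (norm (V $ i))\<^sup>2 / (A $ i \<bullet> V $ i))"
  shows "(\<Sum>i\<in>UNIV. p $ i * (norm (e - ((A $ i \<bullet> e) / (A $ i \<bullet> V $ i)) *\<^sub>R V $ i))\<^sup>2) =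
    (norm e)\<^sup>2 -
    e \<bullet> ((transpose V ** D ** A + transpose A ** D ** V - transpose A ** S ** D ** A) *v e)"
proof -
  let ?d = "\<lambda>i. p $ i / (A $ i \<bullet> V $ i)"
  let ?s = "\<lambda>i. (norm (V $ i))\<^sup>2 / (A $ i \<bullet> V $ i)"
  have norm_sq: "(norm (e - c *\<^sub>R v))\<^sup>2 = (norm e)\<^sup>2 - 2 * c * (v \<bullet> e) + c\<^sup>2 * (norm v)\<^sup>2"
    for c and v :: "real ^ 'n"
    unfolding power2_norm_eq_inner
    by (simp add: inner_diff_left inner_diff_right inner_commute[of e v] power2_eq_square right_diff_distrib)
  have "e \<bullet> ((transpose V ** D ** A + transpose A ** D ** V - transpose A ** S ** D ** A) *v e) =
      (\<Sum>i\<in>UNIV. 2 * (?d i * (A $ i \<bullet> e) * (V $ i \<bullet> e)) - ?s i * ?d i * (A $ i \<bullet> e)\<^sup>2)"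
    unfolding D_def S_def
    by (simp add: matrix_vector_mult_diff_rdistrib matrix_vector_mult_add_rdistrib Diag_mult_Diag
        matrix_mul_assoc[of _ "Diag _" "Diag _", symmetric] transpose_Diag_mult_vec
        inner_diff_right inner_add_right inner_sum_right inner_commute[of e] power2_eq_square
        sum_subtractf sum.distrib[symmetric] algebra_simps)
  moreover have "p $ i * (norm (e - ((A $ i \<bullet> e) / (A $ i \<bullet> V $ i)) *\<^sub>R V $ i))\<^sup>2 =
      p $ i * (norm e)\<^sup>2 -
      (2 * (?d i * (A $ i \<bullet> e) * (V $ i \<bullet> e)) - ?s i * ?d i * (A $ i \<bullet> e)\<^sup>2)" for i
    unfolding norm_sq using av[of i] by (simp add: power2_eq_square field_simps)
  ultimately show ?thesis
    using p1 by (simp add: sum_subtractf sum_distrib_right[symmetric])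
qed

theorem theorem4p1:
  fixes A V :: "real ^ 'n ^ 'm"
    and b p :: "real ^ 'm"
    and Z :: "real ^ 'm ^ 'n"
    and D S :: "real ^ 'm ^ 'm"
    and \<Omega> :: "'w measure"
    and idx :: "nat \<Rightarrow> 'w \<Rightarrow> 'm"
    and x0 :: "real ^ 'n"
    and x :: "nat \<Rightarrow> 'w \<Rightarrow> real ^ 'n"
  assumes "CARD('m) \<le> CARD('n)"
    and "rank A = CARD('m)" and "rank V = CARD('m)"
    and "invertible (A ** transpose V)"
    and "\<And>i. A $ i \<bullet> V $ i > 0"
    and "orthonormal_basis_columns Z (matrix_range (transpose V))"
    and "\<And>i. p $ i \<ge> 0" and "(\<Sum>i\<in>UNIV. p $ i) = 1"
    and "D = Diag (\<chi> i. p $ i / (A $ i \<bullet> V $ i))"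
    and "S = Diag (\<chi> i. (norm (V $ i))\<^sup>2 / (A $ i \<bullet> V $ i))"
    and "prob_space \<Omega>"
    and "prob_space.indep_vars \<Omega> (\<lambda>_. count_space UNIV) idx UNIV"
    and "\<And>k i. measure \<Omega> {\<omega> \<in> space \<Omega>. idx k \<omega> = i} = p $ i"
    and "\<And>k \<omega>. x k \<omega> = kaczmarz_mismatched A V b x0 (\<lambda>j. idx j \<omega>) k"
  shows "(\<exists>!xh. A *v xh = b \<and> xh \<in> matrix_range (transpose V)) \<and>
    (\<forall>xh. A *v xh = b \<and> xh \<in> matrix_range (transpose V) \<longrightarrow>
      (x0 \<in> matrix_range (transpose V) \<and>
       matrix_spectral_radius (mat 1 - transpose Z ** transpose V ** D ** A ** Z) < 1 \<longrightarrow>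
         (\<lambda>k. LINT \<omega>|\<Omega>. (x k \<omega> - xh)) \<longlonglongrightarrow> 0) \<and>
      (\<forall>l. l = matrix_lambda_min (transpose Z **
                 (transpose V ** D ** A + transpose A ** D ** V - transpose A ** S ** D ** A) ** Z) \<and>
           x0 \<in> matrix_range (transpose V) \<and> l > 0 \<longrightarrow>
         (\<forall>k. (LINT \<omega>|\<Omega>. (norm (x (Suc k) \<omega> - xh))\<^sup>2)
                \<le> (1 - l) * (LINT \<omega>|\<Omega>. (norm (x k \<omega> - xh))\<^sup>2))))"
proof -
  interpret prob_space \<Omega> by fact
  note inv = assms(4) and av = assms(5) and Z = assms(6) and p1 = assms(8) and D = assms(9)
    and S = assms(10) and indep = assms(12) and dist = assms(13) and x = assms(14)
  let ?W = "matrix_range (transpose V)"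
  let ?K = "transpose V ** D ** A"
  let ?c = "\<lambda>i e. (A $ i \<bullet> e) / (A $ i \<bullet> V $ i)"
  have W: "subspace ?W"
    unfolding matrix_range_def by (intro linear_subspace_image matrix_vector_mul_linear) auto
  have V_W: "V $ i \<in> ?W" for i
    using rangeI[of "(*v) (transpose V)" "axis i 1"]
    by (simp only: matrix_range_def matrix_vector_mult_basis column_transpose row_def vec_lambda_eta)
  have ZtZ: "transpose Z ** Z = mat 1"
    using Z by (rule orthonormal_basis_columns_transpose_mult)
  have ZtZ': "transpose Z *v (Z *v y) = y" for y
    by (simp add: matrix_vector_mul_assoc ZtZ)
  have W_Z: "?W = range ((*v) Z)" using Z by (rule orthonormal_basis_columns_range)
  have idx: "idx j \<in> measurable \<Omega> (count_space UNIV)" for j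
    using indep unfolding indep_vars_def by auto
  have x_int: "integrable \<Omega> (\<lambda>\<omega>. G (x k \<omega>))" if "continuous_on UNIV G"
    for G :: "real ^ 'n \<Rightarrow> 'c::{banach, second_countable_topology}" and k
    unfolding x using idx that by (rule integrable_continuous_kaczmarz_mismatched)
  obtain C where C: "(A ** transpose V) ** C = mat 1" "C ** (A ** transpose V) = mat 1"
    using inv unfolding invertible_def by blast
  have "\<exists>!xh. A *v xh = b \<and> xh \<in> ?W"
  proof (rule ex_ex1I)
    \<comment> \<open>The witness is V^T (A V^T)^{-1} b.\<close>
    have "A *v (transpose V *v (C *v b)) = b"
      by (simp only: matrix_vector_mul_assoc matrix_mul_assoc C matrix_vector_mul_lid)
    then show "\<exists>xh. A *v xh = b \<and> xh \<in> ?W" unfolding matrix_range_def by blast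
  next
    fix y z assume "A *v y = b \<and> y \<in> ?W" "A *v z = b \<and> z \<in> ?W"
    then obtain y' z' where *: "y = transpose V *v y'" "z = transpose V *v z'"
      and "A *v y = A *v z"
      unfolding matrix_range_def by (metis imageE)
    then have eq: "(A ** transpose V) *v y' = (A ** transpose V) *v z'"
      by (simp only: matrix_vector_mul_assoc)
    have "y' = z'"
      using arg_cong[OF eq, of "(*v) C"] by (simp only: matrix_vector_mul_assoc C matrix_vector_mul_lid)
    with * show "y = z" by simp
  qed
  moreover
  {
    fix xh assume xh: "A *v xh = b" "xh \<in> ?W" and x0: "x0 \<in> ?W"
    \<comment> \<open>Consistency b = A xh removes the inhomogeneous term: the update acts linearly
      on the error.\<close>
    have res: "A $ i \<bullet> y - b $ i = A $ i \<bullet> (y - xh)" for i y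
      unfolding xh(1)[symmetric] matrix_vector_mul_component by (simp add: inner_diff_right)
    have step: "expectation (\<lambda>\<omega>. F (x (Suc k) \<omega> - xh)) =
        (\<Sum>i\<in>UNIV. p $ i * expectation (\<lambda>\<omega>. F ((x k \<omega> - xh) - ?c i (x k \<omega> - xh) *\<^sub>R V $ i)))"
      if "continuous_on UNIV F" for F :: "real ^ 'n \<Rightarrow> real" and k
    proof -
      have "continuous_on UNIV (\<lambda>y. F (y - xh))"
        by (intro continuous_on_compose2[OF that] continuous_intros) auto
      from expectation_kaczmarz_mismatched_Suc[OF indep this, of A V b x0 k]
      moreover have "y - z - xh = y - xh - z" for y z by simp
      ultimately show ?thesis
        by (simp add: dist x[symmetric] res del: kaczmarz_mismatched.simps)
    qed
    have e_W: "x k \<omega> - xh \<in> ?W" for k \<omega>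
    proof -
      have "x k \<omega> \<in> ?W"
      proof (induction k)
        case 0
        show ?case by (simp add: x x0)
      next
        case (Suc k)
        have "x (Suc k) \<omega> = x k \<omega> - ?c (idx k \<omega>) (x k \<omega> - xh) *\<^sub>R V $ idx k \<omega>"
          by (simp add: x Let_def res)
        with Suc show ?case by (metis subspace_diff[OF W] subspace_scale[OF W] V_W)
      qed
      then show ?thesis using xh(2) by (intro subspace_diff[OF W])
    qed
    have "(\<lambda>k. LINT \<omega>|\<Omega>. (x k \<omega> - xh)) \<longlonglongrightarrow> 0"
      if rho: "matrix_spectral_radius (mat 1 - transpose Z ** transpose V ** D ** A ** Z) < 1"
    proof -
      let ?M = "mat 1 - transpose Z ** transpose V ** D ** A ** Z"
      define m where "m k = expectation (\<lambda>\<omega>. x k \<omega> - xh)" for k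
      have e_int: "integrable \<Omega> (\<lambda>\<omega>. x k \<omega> - xh)" for k
        by (rule x_int) (intro continuous_intros)
      have m_Suc: "m (Suc k) = m k - ?K *v m k" for k
      \<comment> \<open>The one-step formula is for real-valued functions, so the vector identity is
        tested against an arbitrary \<open>u\<close>.\<close>
      proof (rule vector_eq_ldot[THEN iffD1], rule allI)
        fix u
        have "u \<bullet> m (Suc k) = expectation (\<lambda>\<omega>. u \<bullet> (x (Suc k) \<omega> - xh))"
          unfolding m_def using e_int by (intro integral_inner_right[symmetric]) auto
        also have "\<dots> = (\<Sum>i\<in>UNIV. p $ i *
            expectation (\<lambda>\<omega>. u \<bullet> ((x k \<omega> - xh) - ?c i (x k \<omega> - xh) *\<^sub>R V $ i)))"
          by (intro step continuous_intros)
        also have "\<dots> = (\<Sum>i\<in>UNIV. p $ i * (u \<bullet> (m k - ?c i (m k) *\<^sub>R V $ i)))"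
        proof (intro sum.cong refl arg_cong2[where f = "(*)"])
          fix i
          have "bounded_linear (\<lambda>e. u \<bullet> (e - ?c i e *\<^sub>R V $ i))"
            unfolding linear_conv_bounded_linear[symmetric]
            by (rule linearI)
              (simp_all add: inner_add_right inner_diff_right add_divide_distrib algebra_simps)
          from integral_bounded_linear[OF this e_int[of k]]
          show "expectation (\<lambda>\<omega>. u \<bullet> ((x k \<omega> - xh) - ?c i (x k \<omega> - xh) *\<^sub>R V $ i))
              = u \<bullet> (m k - ?c i (m k) *\<^sub>R V $ i)"
            by (simp add: m_def)
        qed
        also have "\<dots> = u \<bullet> (m k - ?K *v m k)"
          using p1 by (simp add: D transpose_Diag_mult_vec inner_diff_right inner_sum_right
              right_diff_distrib sum_subtractf sum_distrib_right[symmetric] mult.assoc)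
        finally show "u \<bullet> m (Suc k) = u \<bullet> (m k - ?K *v m k)" .
      qed
      have "m 0 = x0 - xh" by (simp add: m_def x prob_space)
      then have "m 0 \<in> ?W" using x0 xh(2) by (simp add: subspace_diff[OF W])
      then obtain w where w: "m 0 = Z *v w" by (auto simp: W_Z)
      have m_pow: "m k = Z *v (((*v) ?M ^^ k) w)" for k
      proof (induction k)
        case (Suc k)
        let ?w = "((*v) ?M ^^ k) w"
        \<comment> \<open>Because this vector is in the range of \<open>Z\<close>, applying Z Z^T
          leaves it unchanged; hence \<open>Z\<close> intertwines \<open>?M\<close> with I - V^T D
          A.\<close>
        have "?K *v (Z *v ?w) \<in> ?W"
          by (simp add: matrix_range_def matrix_vector_mul_assoc[symmetric] del: transpose_matrix_vector)
        then obtain z where z: "?K *v (Z *v ?w) = Z *v z" by (auto simp: W_Z)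
        then have "z = transpose Z *v (?K *v (Z *v ?w))" by (simp only: ZtZ')
        then have "?M *v ?w = ?w - z"
          by (simp add: matrix_vector_mult_diff_rdistrib matrix_vector_mul_assoc matrix_mul_assoc)
        then show ?case by (simp add: m_Suc Suc z matrix_vector_mult_diff_distrib)
      qed (simp add: w)
      have "(\<lambda>k. Z *v (((*v) ?M ^^ k) w)) \<longlonglongrightarrow> Z *v 0"
        by (intro bounded_linear.tendsto[OF matrix_vector_mul_bounded_linear] real_matrix_power_tendsto_0 rho)
      then show ?thesis by (simp add: m_pow[symmetric] m_def)
    qed
    moreover have "(LINT \<omega>|\<Omega>. (norm (x (Suc k) \<omega> - xh))\<^sup>2) \<le> (1 - l) * (LINT \<omega>|\<Omega>. (norm (x k \<omega> - xh))\<^sup>2)"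
      if l: "l = matrix_lambda_min (transpose Z **
        (transpose V ** D ** A + transpose A ** D ** V - transpose A ** S ** D ** A) ** Z)" for k l
    proof -
      let ?N = "transpose V ** D ** A + transpose A ** D ** V - transpose A ** S ** D ** A"
      let ?e = "\<lambda>\<omega>. x k \<omega> - xh"
      have sum_norm: "(\<Sum>i\<in>UNIV. p $ i * (norm (e - ?c i e *\<^sub>R V $ i))\<^sup>2) = (norm e)\<^sup>2 - e \<bullet> (?N *v e)" for e
        unfolding D S using p1 less_imp_neq[OF av, symmetric] by (intro sum_norm_kaczmarz_step) auto
      \<comment> \<open>Diagonal matrices commute, which makes A^T S D A symmetric; the other two
        terms of \<open>?N\<close> are transposes of each other.\<close>
      have DS: "D ** (S ** B) = S ** (D ** B)" for B :: "real ^ 'n ^ 'm"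
        by (simp add: matrix_mul_assoc D S Diag_mult_Diag mult.commute)
      have DT: "transpose D = D" "transpose S = S" by (simp_all add: D S transpose_Diag)
      have sym: "transpose (transpose Z ** ?N ** Z) = transpose Z ** ?N ** Z"
        by (simp add: matrix_transpose_mul transpose_add transpose_diff
            matrix_mul_assoc[symmetric] DT DS add.commute)
      have form: "l * (norm e)\<^sup>2 \<le> e \<bullet> (?N *v e)" if "e \<in> ?W" for e
      proof -
        from that obtain y where y: "e = Z *v y" by (auto simp: W_Z)
        have "l * (y \<bullet> y) \<le> y \<bullet> ((transpose Z ** ?N ** Z) *v y)"
          unfolding l by (rule matrix_lambda_min_le_quadratic_form[OF sym])
        moreover have "y \<bullet> y = (norm e)\<^sup>2"
          by (simp only: y power2_norm_eq_inner inner_matrix_vector_mult ZtZ')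
        moreover have "y \<bullet> ((transpose Z ** ?N ** Z) *v y) = e \<bullet> (?N *v e)"
          unfolding y
          by (simp only: matrix_vector_mul_assoc[symmetric] inner_matrix_vector_mult[of y] transpose_transpose)
        ultimately show ?thesis by simp
      qed
      have "expectation (\<lambda>\<omega>. (norm (x (Suc k) \<omega> - xh))\<^sup>2) =
          (\<Sum>i\<in>UNIV. p $ i * expectation (\<lambda>\<omega>. (norm (?e \<omega> - ?c i (?e \<omega>) *\<^sub>R V $ i))\<^sup>2))"
        by (intro step continuous_intros)
      \<comment> \<open>The sum moves inside the expectation so that the quadratic form bound can be
        applied at each sample point, where the error lies in rg V^T.\<close>
      also have "\<dots> = expectation (\<lambda>\<omega>. \<Sum>i\<in>UNIV. p $ i * (norm (?e \<omega> - ?c i (?e \<omega>) *\<^sub>R V $ i))\<^sup>2)"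
        by (subst Bochner_Integration.integral_sum)
          (auto intro!: integrable_mult_right x_int continuous_intros simp: less_imp_neq[OF av, symmetric])
      also have "\<dots> \<le> expectation (\<lambda>\<omega>. (1 - l) * (norm (?e \<omega>))\<^sup>2)"
      proof (rule integral_mono)
        show "(\<Sum>i\<in>UNIV. p $ i * (norm (?e \<omega> - ?c i (?e \<omega>) *\<^sub>R V $ i))\<^sup>2) \<le> (1 - l) * (norm (?e \<omega>))\<^sup>2" for \<omega>
          using form[OF e_W[of k \<omega>]] unfolding sum_norm left_diff_distrib by simp
      qed (auto intro!: x_int continuous_intros simp: less_imp_neq[OF av, symmetric])
      finally show ?thesis by simp
    qed
    ultimately have "(matrix_spectral_radius (mat 1 - transpose Z ** transpose V ** D ** A ** Z) < 1 \<longrightarrow>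
         (\<lambda>k. LINT \<omega>|\<Omega>. (x k \<omega> - xh)) \<longlonglongrightarrow> 0) \<and>
      (\<forall>l. l = matrix_lambda_min (transpose Z **
                 (transpose V ** D ** A + transpose A ** D ** V - transpose A ** S ** D ** A) ** Z) \<longrightarrow>
         (\<forall>k. (LINT \<omega>|\<Omega>. (norm (x (Suc k) \<omega> - xh))\<^sup>2)
                \<le> (1 - l) * (LINT \<omega>|\<Omega>. (norm (x k \<omega> - xh))\<^sup>2)))"
      by blast
  }
  ultimately show ?thesis by blast
qed

end
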